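(* Let $\mathcal R$ be a commutative ELT ring and let $A\in(\overline{\mathcal R})^{n\times n}$. Then $A$ is quasi-invertible if and only if $\det(A)$ is invertible in $\mathcal R$.
   Context: Let $F$ be a totally ordered abelian group (written additively) and $L$ a commutative ring with $1\neq 0$. The commutative ELT ring $\mathcal R=\mathscr R(L,F)$ is the set of symbols ${}^{[\ell]}a$ ($a\in F$, $\ell\in L$) with multiplication ${}^{[\ell_1]}a_1\cdot{}^{[\ell_2]}a_2={}^{[\ell_1\ell_2]}(a_1+a_2)$ and addition ${}^{[\ell_1]}a_1+{}^{[\ell_2]}a_2$ equal to ${}^{[\ell_1]}a_1$ if $a_1>a_2$, to ${}^{[\ell_2]}a_2$ if $a_1<a_2$, and to ${}^{[\ell_1+\ell_2]}a_1$ if $a_1=a_2$. The layer of ${}^{[\ell]}a$ is $s({}^{[\ell]}a)=\ell$. Set $\overline{\mathcal R}=\mathcal R\cup\{-\infty\}$, where $-\infty+\alpha=\alpha+(-\infty)=\alpha$, $-\infty\cdot\alpha=\alpha\cdot(-\infty)=-\infty$ and $s(-\infty)=0$; this is a commutative semiring with zero $-\infty$ and unit ${}^{[1]}0$. Matrices over $\overline{\mathcal R}$ are multiplied as usual, and $\det(A)=\sum_{\sigma\in S_n}{}^{[\operatorname{sgn}\sigma]}0\cdot a_{1,\sigma(1)}\cdots a_{n,\sigma(n)}$. A matrix is nonsingular if the layer of its determinant is nonzero. A quasi-identity matrix is a matrix $\tilde I\in(\overline{\mathcal R})^{n\times n}$ which is idempotent ($\tilde I^2=\tilde I$), nonsingular,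 has all diagonal entries equal to ${}^{[1]}0$, and has all off-diagonal entries $\alpha_{i,j}\in\overline{\mathcal R}$ of layer $s(\alpha_{i,j})=0$. A matrix $B\in(\overline{\mathcal R})^{n\times n}$ is a quasi-inverse of $A$ if $AB$ and $BA$ are both quasi-identity matrices ($AB$ and $BA$ may differ); $A$ is quasi-invertible if it has a quasi-inverse. *)

theory Defs
  imports "HOL-Analysis.Determinants"
begin

text \<open>
  The type \<open>('l, 'f) elt\<close> is the semiring \<open>\<R>(L, F) \<union> {-\<infinity>}\<close>: \<open>Layered l a\<close> is the symbol with
  layer \<open>l\<close> and value \<open>a\<close>. The zero of the semiring is \<open>NegInf\<close>; the symbols \<open>Layered 0 a\<close> of
  layer zero are distinct from it.
\<close>

datatype ('l, 'f) elt = NegInf | Layered 'l 'f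

fun layer :: "('l::zero, 'f) elt \<Rightarrow> 'l" where
  "layer NegInf = 0"
| "layer (Layered l a) = l"

instantiation elt :: (comm_ring_1, linordered_ab_group_add) comm_semiring_1
begin

definition zero_elt :: "('a, 'b) elt" where
  "zero_elt = NegInf"

definition one_elt :: "('a, 'b) elt" where
  "one_elt = Layered 1 0"

fun plus_elt :: "('a, 'b) elt \<Rightarrow> ('a, 'b) elt \<Rightarrow> ('a, 'b) elt" where
  "plus_elt NegInf y = y"
| "plus_elt x NegInf = x"
| "plus_elt (Layered l a) (Layered m b) =
     (if a > b then Layered l a else if a < b then Layered m b else Layered (l + m) a)"

fun times_elt :: "('a, 'b) elt \<Rightarrow> ('a, 'b) elt \<Rightarrow> ('a, 'b) elt" where
  "times_elt NegInf y = NegInf"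
| "times_elt x NegInf = NegInf"
| "times_elt (Layered l a) (Layered m b) = Layered (l * m) (a + b)"

instance
proof
  fix x y z :: "('a, 'b) elt"
  show "x + y + z = x + (y + z)"
    by (cases x; cases y; cases z) (auto simp: add.assoc)
  show "x + y = y + x"
    by (cases x; cases y) (auto simp: add.commute)
  show "0 + x = x"
    by (simp add: zero_elt_def)
  show "x * y * z = x * (y * z)"
    by (cases x; cases y; cases z) (auto simp: ac_simps)
  show "x * y = y * x"
    by (cases x; cases y) (auto simp: ac_simps)
  show "1 * x = x"
    by (cases x) (auto simp: one_elt_def)
  show "0 * x = 0" and "x * 0 = 0"
    by (cases x; simp add: zero_elt_def)+
  show "(x + y) * z = x * z + y * z"
    by (cases x; cases y; cases z) (auto simp: distrib_right)
  show "(0::('a, 'b) elt) \<noteq> 1"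
    by (simp add: zero_elt_def one_elt_def)
qed

end

text \<open>The ELT ring itself, that is, without \<open>-\<infinity>\<close>.\<close>

definition elt_ring :: "('l, 'f) elt set" where
  "elt_ring = {Layered l a | l a. True}"

definition invertible_in_elt_ring ::
    "('l::comm_ring_1, 'f::linordered_ab_group_add) elt \<Rightarrow> bool" where
  "invertible_in_elt_ring x \<longleftrightarrow> x \<in> elt_ring \<and> (\<exists>y\<in>elt_ring. x * y = 1)"

text \<open>
  The library's \<^const>\<open>det\<close> needs entries in a ring; here the sign of a permutation enters as the
  layer of a symbol of value \<open>0\<close>.
\<close>

definition elt_det ::
    "('l::comm_ring_1, 'f::linordered_ab_group_add) elt ^ 'n ^ 'n \<Rightarrow> ('l, 'f) elt" where
  "elt_det A =
     (\<Sum>\<sigma> | \<sigma> permutes (UNIV :: 'n set).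
        Layered (of_int (sign \<sigma>)) 0 * (\<Prod>i\<in>UNIV. A $ i $ \<sigma> i))"

definition elt_nonsingular ::
    "('l::comm_ring_1, 'f::linordered_ab_group_add) elt ^ 'n ^ 'n \<Rightarrow> bool" where
  "elt_nonsingular A \<longleftrightarrow> layer (elt_det A) \<noteq> 0"

definition quasi_identity ::
    "('l::comm_ring_1, 'f::linordered_ab_group_add) elt ^ 'n ^ 'n \<Rightarrow> bool" where
  "quasi_identity E \<longleftrightarrow>
     E ** E = E \<and>
     elt_nonsingular E \<and>
     (\<forall>i. E $ i $ i = Layered 1 0) \<and>
     (\<forall>i j. i \<noteq> j \<longrightarrow> layer (E $ i $ j) = 0)"

definition quasi_inverse ::
    "('l::comm_ring_1, 'f::linordered_ab_group_add) elt ^ 'n ^ 'n \<Rightarrow>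
     ('l, 'f) elt ^ 'n ^ 'n \<Rightarrow> bool" where
  "quasi_inverse A B \<longleftrightarrow> quasi_identity (A ** B) \<and> quasi_identity (B ** A)"

definition quasi_invertible ::
    "('l::comm_ring_1, 'f::linordered_ab_group_add) elt ^ 'n ^ 'n \<Rightarrow> bool" where
  "quasi_invertible A \<longleftrightarrow> (\<exists>B. quasi_inverse A B)"

end

theory Submission imports Defs begin

text \<open>
  An element carries a value in \<open>F \<union> {-\<infinity>}\<close> and a layer in \<open>L\<close>. Taking values is a homomorphism to
  the max-plus semiring, and the elements of layer zero form an ideal; an element of layer zero is
  absorbed by every summand of at least its value. An identity over a commutative ring that rests
  on cancelling terms in pairs therefore survives up to a summand of layer zero. That summand
  disappears if its value is dominated, or if the layer of the whole sum is nonzero.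

  Suppose that \<open>A B\<close> is a quasi-identity. Every term of \<open>det (A B)\<close> other than the product of the
  diagonal has layer zero, so nonsingularity forces \<open>det (A B) = 1\<close>. Moreover \<open>det (A B)\<close> differs
  from \<open>det A * det B\<close> only by a summand of layer zero, which comes from determinants with a
  repeated row (\<open>elt_det_mult_layer_zero\<close>). As the layer of \<open>1\<close> is nonzero, the product itself must
  be \<open>1\<close>.

  Conversely, suppose that \<open>d\<close> is inverse to \<open>det A\<close>, and let \<open>B\<close> be \<open>d\<close> times the adjugate of \<open>A\<close>. By
  Laplace expansion the entry \<open>(i, j)\<close> of \<open>E = A B\<close> is \<open>d\<close> times the determinant of \<open>A\<close> with row
  \<open>j\<close> replaced by row \<open>i\<close>. The diagonal entries are thus \<open>1\<close>, and the others have layer zero because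
  of the repeated row. What remains is a statement about values: the value of
  \<open>E\<^sub>i\<^sub>k * E\<^sub>k\<^sub>j\<close> is at most that of \<open>E\<^sub>i\<^sub>j\<close>. It follows from an exchange inequality
  (\<open>elt_det_exchange\<close>): two permutation terms for the left-hand side are recombined into a term of
  \<open>det A\<close> and a term of the determinant with row \<open>j\<close> replaced by row \<open>i\<close>, by swapping the rows
  assigned to the columns along an orbit. This transitivity of values makes \<open>E\<close> idempotent, and it
  bounds every term of \<open>det E\<close> by \<open>1\<close>, so that \<open>det E = 1\<close> (\<open>quasi_identity_if_transitive\<close>). The
  product \<open>B A\<close> is handled by transposition.
\<close>

section \<open>Comparison of values and the ideal of layer zero\<close>

text \<open>
  Only values are compared. Elements of equal value and different layers lie below each other, so
  the relation is a preorder and no partial order.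
\<close>

fun value_le :: "('l, 'f::linorder) elt \<Rightarrow> ('l, 'f) elt \<Rightarrow> bool" (infix "\<preceq>" 50) where
  "NegInf \<preceq> y \<longleftrightarrow> True"
| "Layered l a \<preceq> NegInf \<longleftrightarrow> False"
| "Layered l a \<preceq> Layered m b \<longleftrightarrow> a \<le> b"

lemma value_le_refl [simp]: "x \<preceq> x"
  by (cases x) auto

lemma value_le_trans [trans]: "x \<preceq> y \<Longrightarrow> y \<preceq> z \<Longrightarrow> x \<preceq> z"
  by (cases x; cases y; cases z) auto

lemma value_le_add_right: "x \<preceq> x + y"
  for x y :: "('l::comm_ring_1, 'f::linordered_ab_group_add) elt"
  by (cases x; cases y) auto

lemma value_le_add: "x \<preceq> z \<Longrightarrow> y \<preceq> z \<Longrightarrow> x + y \<preceq> z"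
  for x y z :: "('l::comm_ring_1, 'f::linordered_ab_group_add) elt"
  by (cases x; cases y; cases z) auto

lemma value_le_mult: "x \<preceq> y \<Longrightarrow> z \<preceq> w \<Longrightarrow> x * z \<preceq> y * w"
  for x y z w :: "('l::comm_ring_1, 'f::linordered_ab_group_add) elt"
  by (cases x; cases y; cases z; cases w) (auto intro: add_mono)

lemma value_le_sum:
  fixes f :: "'a \<Rightarrow> ('l::comm_ring_1, 'f::linordered_ab_group_add) elt"
  assumes "\<And>x. x \<in> S \<Longrightarrow> f x \<preceq> z"
  shows "sum f S \<preceq> z"
  using assms by (induction S rule: infinite_finite_induct) (auto simp: zero_elt_def intro: value_le_add)

lemma member_value_le_sum:
  fixes f :: "'a \<Rightarrow> ('l::comm_ring_1, 'f::linordered_ab_group_add) elt"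
  assumes "finite S" "x \<in> S"
  shows "f x \<preceq> sum f S"
  using assms by (simp add: sum.remove value_le_add_right)

lemma layer_zero_add: "layer x = 0 \<Longrightarrow> layer y = 0 \<Longrightarrow> layer (x + y) = 0"
  for x y :: "('l::comm_ring_1, 'f::linordered_ab_group_add) elt"
  by (cases x; cases y) auto

lemma layer_mult: "layer (x * y) = layer x * layer y"
  for x y :: "('l::comm_ring_1, 'f::linordered_ab_group_add) elt"
  by (cases x; cases y) auto

lemma layer_zero_sum:
  fixes f :: "'a \<Rightarrow> ('l::comm_ring_1, 'f::linordered_ab_group_add) elt"
  assumes "\<And>x. x \<in> S \<Longrightarrow> layer (f x) = 0"
  shows "layer (sum f S) = 0"
  using assms
  by (induction S rule: infinite_finite_induct) (auto simp: zero_elt_def layer_zero_add)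

lemma layer_zero_prod:
  fixes f :: "'a \<Rightarrow> ('l::comm_ring_1, 'f::linordered_ab_group_add) elt"
  assumes "finite S" "x \<in> S" "layer (f x) = 0"
  shows "layer (prod f S) = 0"
  using assms by (simp add: prod.remove layer_mult)

text \<open>
  Addition does not change a dominating summand, and at equal values the layer zero adds nothing.
\<close>

lemma layer_zero_absorbed: "layer x = 0 \<Longrightarrow> x \<preceq> y \<Longrightarrow> y + x = y"
  for x y :: "('l::comm_ring_1, 'f::linordered_ab_group_add) elt"
  by (cases x; cases y) auto

text \<open>
  If the summand of layer zero had a value exceeding that of \<open>x\<close>, it would be the whole sum.
\<close>

lemma add_layer_zero_cancel:
  fixes x z :: "('l::comm_ring_1, 'f::linordered_ab_group_add) elt"
  assumes "layer z = 0" "layer (x + z) \<noteq> 0"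
  shows "x + z = x"
  using assms by (cases x; cases z) (auto split: if_splits)

lemma layer_add_negative: "layer (x + Layered (- 1) 0 * x) = 0"
  for x :: "('l::comm_ring_1, 'f::linordered_ab_group_add) elt"
  by (cases x) auto

section \<open>The determinant under operations on rows\<close>

definition sign_elt :: "('n \<Rightarrow> 'n) \<Rightarrow> ('l::comm_ring_1, 'f::linordered_ab_group_add) elt" where
  "sign_elt \<sigma> = Layered (of_int (sign \<sigma>)) 0"

definition select_rows :: "'a ^ 'm ^ 'n \<Rightarrow> ('k \<Rightarrow> 'n) \<Rightarrow> 'a ^ 'm ^ 'k" where
  "select_rows A f = (\<chi> r. A $ f r)"

lemma elt_det_sign_elt:
  "elt_det A = (\<Sum>\<sigma> | \<sigma> permutes (UNIV :: 'n::finite set). sign_elt \<sigma> * (\<Prod>i\<in>UNIV. A $ i $ \<sigma> i))"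
  by (simp add: elt_det_def sign_elt_def)

lemma permutation_if_permutes_UNIV: "\<sigma> permutes (UNIV :: 'n::finite set) \<Longrightarrow> permutation \<sigma>"
  by (auto simp: permutation_permutes)

lemma sign_elt_compose:
  fixes \<sigma> \<tau> :: "'n::finite \<Rightarrow> 'n"
  assumes "\<sigma> permutes UNIV" "\<tau> permutes UNIV"
  shows "sign_elt (\<sigma> \<circ> \<tau>) = sign_elt \<sigma> * sign_elt \<tau>"
  using assms by (simp add: sign_elt_def sign_compose permutation_if_permutes_UNIV)

lemma sign_elt_value_le_one: "sign_elt \<sigma> \<preceq> 1"
  by (simp add: sign_elt_def one_elt_def)

lemma one_value_le_sign_elt: "1 \<preceq> sign_elt \<sigma>"
  by (simp add: sign_elt_def one_elt_def)

lemma prod_permuted_rows: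
  fixes A :: "('l::comm_ring_1, 'f::linordered_ab_group_add) elt ^ 'm ^ 'n"
  assumes "\<alpha> permutes (UNIV :: 'n set)"
  shows "(\<Prod>r\<in>UNIV. A $ \<alpha> r $ \<sigma> (\<alpha> r)) = (\<Prod>r\<in>UNIV. A $ r $ \<sigma> r)"
  using prod.permute[OF assms, of "\<lambda>r. A $ r $ \<sigma> r"] by (simp add: o_def)

lemma elt_det_permute_rows:
  fixes A :: "('l::comm_ring_1, 'f::linordered_ab_group_add) elt ^ 'n ^ 'n"
  assumes p: "p permutes UNIV"
  shows "elt_det (select_rows A p) = sign_elt p * elt_det A"
proof -
  have "elt_det (select_rows A p) =
    (\<Sum>\<sigma> | \<sigma> permutes UNIV. sign_elt (\<sigma> \<circ> p) * (\<Prod>r\<in>UNIV. A $ p r $ \<sigma> (p r)))"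
    unfolding elt_det_sign_elt select_rows_def
    by (subst sum_permutations_compose_right[OF p]) simp
  also have "\<dots> = (\<Sum>\<sigma> | \<sigma> permutes UNIV. sign_elt p * (sign_elt \<sigma> * (\<Prod>r\<in>UNIV. A $ r $ \<sigma> r)))"
    by (rule sum.cong) (auto simp: prod_permuted_rows[OF p] sign_elt_compose p ac_simps)
  finally show ?thesis
    by (simp add: elt_det_sign_elt sum_distrib_left)
qed

lemma elt_det_transpose:
  fixes A :: "('l::comm_ring_1, 'f::linordered_ab_group_add) elt ^ 'n ^ 'n"
  shows "elt_det (transpose A) = elt_det A"
proof -
  have "elt_det (transpose A) =
      (\<Sum>\<sigma> | \<sigma> permutes UNIV. sign_elt (inv \<sigma>) * (\<Prod>r\<in>UNIV. A $ inv \<sigma> r $ r))"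
    unfolding elt_det_sign_elt transpose_def by (subst sum_permutations_inverse) simp
  also have "\<dots> = elt_det A"
    unfolding elt_det_sign_elt
  proof (rule sum.cong)
    fix \<sigma> :: "'n \<Rightarrow> 'n" assume "\<sigma> \<in> {\<sigma>. \<sigma> permutes UNIV}"
    then have \<sigma>: "\<sigma> permutes UNIV" by simp
    have "(\<Prod>r\<in>UNIV. A $ inv \<sigma> r $ r) = (\<Prod>r\<in>UNIV. A $ r $ \<sigma> r)"
      using prod_permuted_rows[OF permutes_inv[OF \<sigma>], of A \<sigma>] by (simp add: permutes_inverses[OF \<sigma>])
    then show "sign_elt (inv \<sigma>) * (\<Prod>r\<in>UNIV. A $ inv \<sigma> r $ r) =
        sign_elt \<sigma> * (\<Prod>r\<in>UNIV. A $ r $ \<sigma> r)"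
      using \<sigma> by (simp add: sign_elt_def sign_inverse permutation_if_permutes_UNIV)
  qed simp
  finally show ?thesis .
qed

text \<open>
  There is no cancellation, but the terms of \<open>\<sigma>\<close> and of \<open>\<sigma>\<close> composed with the transposition of the
  two rows still have equal values and opposite layers.
\<close>

lemma layer_elt_det_equal_rows:
  fixes A :: "('l::comm_ring_1, 'f::linordered_ab_group_add) elt ^ 'n ^ 'n"
  assumes ij: "i \<noteq> j" and rows: "A $ i = A $ j"
  shows "layer (elt_det A) = 0"
proof -
  let ?t = "Transposition.transpose i j"
  let ?f = "\<lambda>\<sigma>. sign_elt \<sigma> * (\<Prod>r\<in>UNIV. A $ r $ \<sigma> r)"
  define ev where "ev = {\<sigma> :: 'n \<Rightarrow> 'n. \<sigma> permutes UNIV \<and> evenperm \<sigma>}"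
  define od where "od = {\<sigma> :: 'n \<Rightarrow> 'n. \<sigma> permutes UNIV \<and> \<not> evenperm \<sigma>}"
  have t: "?t permutes UNIV" by (simp add: permutes_swap_id)
  have even_t: "evenperm (\<sigma> \<circ> ?t) \<longleftrightarrow> \<not> evenperm \<sigma>" if "\<sigma> permutes UNIV" for \<sigma>
    using that t ij by (simp add: evenperm_comp permutation_if_permutes_UNIV evenperm_swap)
  have inj: "inj_on (\<lambda>\<sigma>. \<sigma> \<circ> ?t) ev"
    by (rule inj_onI) (metis comp_assoc swap_id_idempotent comp_id)
  have od_image: "od = (\<lambda>\<sigma>. \<sigma> \<circ> ?t) ` ev"
  proof
    show "od \<subseteq> (\<lambda>\<sigma>. \<sigma> \<circ> ?t) ` ev"
    proof
      fix \<sigma> assume "\<sigma> \<in> od"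
      then have "\<sigma> \<circ> ?t \<in> ev" using t by (auto simp: od_def ev_def even_t permutes_compose)
      moreover have "\<sigma> = (\<sigma> \<circ> ?t) \<circ> ?t" by (simp add: comp_assoc)
      ultimately show "\<sigma> \<in> (\<lambda>\<sigma>. \<sigma> \<circ> ?t) ` ev" by blast
    qed
    show "(\<lambda>\<sigma>. \<sigma> \<circ> ?t) ` ev \<subseteq> od"
      using t by (auto simp: od_def ev_def even_t intro: permutes_compose)
  qed
  have same_row: "A $ ?t r = A $ r" for r
    using rows by (simp add: Transposition.transpose_def)
  have f_t: "?f (\<sigma> \<circ> ?t) = Layered (- 1) 0 * ?f \<sigma>" if "\<sigma> permutes UNIV" for \<sigma>
  proof -
    have "(\<Prod>r\<in>UNIV. A $ r $ (\<sigma> \<circ> ?t) r) = (\<Prod>r\<in>UNIV. A $ r $ \<sigma> r)"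
      using prod_permuted_rows[OF t, of A \<sigma>] by (simp add: same_row)
    moreover have "sign_elt ?t = (Layered (- 1) 0 :: ('l, 'f) elt)"
      using ij by (simp add: sign_elt_def sign_swap_id)
    ultimately show ?thesis
      using that t by (simp add: sign_elt_compose ac_simps)
  qed
  have "elt_det A = sum ?f (ev \<union> od)"
    unfolding elt_det_sign_elt ev_def od_def by (rule sum.cong) auto
  also have "\<dots> = sum ?f ev + sum ?f od"
    by (rule sum.union_disjoint) (auto simp: ev_def od_def finite_permutations)
  also have "sum ?f od = (\<Sum>\<sigma>\<in>ev. ?f (\<sigma> \<circ> ?t))"
    unfolding od_image by (simp add: sum.reindex[OF inj])
  also have "\<dots> = (\<Sum>\<sigma>\<in>ev. Layered (- 1) 0 * ?f \<sigma>)"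
    by (rule sum.cong) (simp_all only: ev_def mem_Collect_eq f_t)
  also have "\<dots> = Layered (- 1) 0 * sum ?f ev"
    by (simp add: sum_distrib_left)
  finally show ?thesis
    by (simp add: layer_add_negative)
qed

lemma layer_elt_det_select_rows_not_inj:
  fixes A :: "('l::comm_ring_1, 'f::linordered_ab_group_add) elt ^ 'n ^ 'n"
  assumes "\<not> inj f"
  shows "layer (elt_det (select_rows A f)) = 0"
proof -
  from assms obtain i j where "i \<noteq> j" "f i = f j" by (auto simp: inj_def)
  then show ?thesis
    by (intro layer_elt_det_equal_rows[of i j]) (auto simp: select_rows_def)
qed

section \<open>Determinants of products\<close>

text \<open>
  In the multilinear expansion of \<open>det (A B)\<close> over all choices of rows of \<open>B\<close>, the injective choices
  contribute \<open>det A * det B\<close>, and every other choice repeats a row of \<open>B\<close>.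
\<close>

lemma elt_det_mult_layer_zero:
  fixes A B :: "('l::comm_ring_1, 'f::linordered_ab_group_add) elt ^ 'n ^ 'n"
  obtains z where "elt_det (A ** B) = elt_det A * elt_det B + z" "layer z = 0"
proof
  let ?g = "\<lambda>f. (\<Prod>i\<in>UNIV. A $ i $ f i) * elt_det (select_rows B f)"
  define z where "z = (\<Sum>f | \<not> f permutes (UNIV :: 'n set). ?g f)"
  have "elt_det (A ** B) =
      (\<Sum>\<sigma> | \<sigma> permutes UNIV. sign_elt \<sigma> * (\<Prod>i\<in>UNIV. \<Sum>k\<in>UNIV. A $ i $ k * B $ k $ \<sigma> i))"
    by (simp add: elt_det_sign_elt matrix_matrix_mult_def)
  also have "\<dots> = (\<Sum>\<sigma> | \<sigma> permutes UNIV. sign_elt \<sigma> *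
      (\<Sum>f\<in>UNIV. (\<Prod>i\<in>UNIV. A $ i $ f i) * (\<Prod>i\<in>UNIV. B $ f i $ \<sigma> i)))"
    by (simp add: prod_sum_PiE prod.distrib)
  also have "\<dots> = (\<Sum>f\<in>UNIV. \<Sum>\<sigma> | \<sigma> permutes UNIV. sign_elt \<sigma> *
      ((\<Prod>i\<in>UNIV. A $ i $ f i) * (\<Prod>i\<in>UNIV. B $ f i $ \<sigma> i)))"
    unfolding sum_distrib_left by (rule sum.swap)
  also have "\<dots> = (\<Sum>f\<in>UNIV. ?g f)"
    by (simp add: elt_det_sign_elt select_rows_def sum_distrib_left ac_simps)
  also have "\<dots> = (\<Sum>f | f permutes UNIV. ?g f) + z"
    unfolding z_def
    by (subst sum.union_disjoint[symmetric]) (auto intro!: sum.cong)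
  also have "(\<Sum>f | f permutes UNIV. ?g f) =
      (\<Sum>f | f permutes UNIV. sign_elt f * (\<Prod>i\<in>UNIV. A $ i $ f i) * elt_det B)"
    by (rule sum.cong) (auto simp: elt_det_permute_rows ac_simps)
  also have "\<dots> = elt_det A * elt_det B"
    by (simp add: elt_det_sign_elt[of A] sum_distrib_right)
  finally show "elt_det (A ** B) = elt_det A * elt_det B + z" .
  show "layer z = 0"
    unfolding z_def
  proof (rule layer_zero_sum)
    fix f :: "'n \<Rightarrow> 'n" assume "f \<in> {f. \<not> f permutes UNIV}"
    then have "\<not> inj f"
      using bij_imp_permutes[of f UNIV] finite_UNIV_inj_surj[of f] by (auto simp: bij_def)
    then show "layer (?g f) = 0"
      by (simp add: layer_mult layer_elt_det_select_rows_not_inj)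
  qed
qed

text \<open>
  A permutation other than the identity moves some index, and so its term has an off-diagonal
  factor, of layer zero.
\<close>

lemma elt_det_unit_diagonal:
  fixes E :: "('l::comm_ring_1, 'f::linordered_ab_group_add) elt ^ 'n ^ 'n"
  assumes diag: "\<And>i. E $ i $ i = 1" and off: "\<And>i j. i \<noteq> j \<Longrightarrow> layer (E $ i $ j) = 0"
  defines "z \<equiv> \<Sum>\<sigma> | \<sigma> permutes UNIV \<and> \<sigma> \<noteq> id. sign_elt \<sigma> * (\<Prod>i\<in>UNIV. E $ i $ \<sigma> i)"
  shows "elt_det E = 1 + z" "layer z = 0"
proof -
  have "{\<sigma> :: 'n \<Rightarrow> 'n. \<sigma> permutes UNIV} = insert id {\<sigma>. \<sigma> permutes UNIV \<and> \<sigma> \<noteq> id}"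
    by (auto simp: permutes_id)
  then have "elt_det E = sign_elt (id :: 'n \<Rightarrow> 'n) * (\<Prod>i\<in>UNIV. E $ i $ id i) + z"
    unfolding elt_det_sign_elt z_def by simp
  then show "elt_det E = 1 + z"
    by (simp add: diag sign_elt_def sign_id one_elt_def [symmetric])
  show "layer z = 0"
    unfolding z_def
  proof (rule layer_zero_sum)
    fix \<sigma> :: "'n \<Rightarrow> 'n" assume "\<sigma> \<in> {\<sigma>. \<sigma> permutes UNIV \<and> \<sigma> \<noteq> id}"
    then obtain i where "\<sigma> i \<noteq> i" by (auto simp: fun_eq_iff)
    then have "layer (\<Prod>i\<in>UNIV. E $ i $ \<sigma> i) = 0"
      by (intro layer_zero_prod[of UNIV i]) (auto simp: off[OF not_sym])
    then show "layer (sign_elt \<sigma> * (\<Prod>i\<in>UNIV. E $ i $ \<sigma> i)) = 0"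
      by (simp add: layer_mult)
  qed
qed

text \<open>
  Both \<open>1\<close> plus a remainder and \<open>det A * det B\<close> plus a remainder equal \<open>det (A B)\<close>, where the
  remainders have layer zero. As \<open>det (A B)\<close> has nonzero layer, neither remainder contributes.
\<close>

lemma elt_det_invertible_if_right_quasi_inverse:
  fixes A B :: "('l::comm_ring_1, 'f::linordered_ab_group_add) elt ^ 'n ^ 'n"
  assumes "quasi_identity (A ** B)"
  shows "invertible_in_elt_ring (elt_det A)"
proof -
  have E: "(A ** B) $ i $ i = 1" "i \<noteq> j \<Longrightarrow> layer ((A ** B) $ i $ j) = 0" for i j
    using assms by (auto simp: quasi_identity_def one_elt_def)
  have nonsingular: "layer (elt_det (A ** B)) \<noteq> 0"
    using assms by (simp add: quasi_identity_def elt_nonsingular_def)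
  obtain z where z: "elt_det (A ** B) = 1 + z" "layer z = 0"
    using elt_det_unit_diagonal[of "A ** B", OF E] by blast
  have det_1: "elt_det (A ** B) = 1"
    using nonsingular unfolding z(1) by (rule add_layer_zero_cancel[OF z(2)])
  obtain w where w: "elt_det (A ** B) = elt_det A * elt_det B + w" "layer w = 0"
    by (rule elt_det_mult_layer_zero)
  have "elt_det A * elt_det B + w = elt_det A * elt_det B"
    using nonsingular unfolding w(1) by (rule add_layer_zero_cancel[OF w(2)])
  then have prod_1: "elt_det A * elt_det B = 1"
    using w(1) det_1 by simp
  then have "elt_det A \<in> elt_ring" "elt_det B \<in> elt_ring"
    by (cases "elt_det A"; cases "elt_det B"; simp add: elt_ring_def one_elt_def)+
  then show ?thesis
    using prod_1 unfolding invertible_in_elt_ring_def by blast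
qed

section \<open>An exchange inequality for determinants with replaced rows\<close>

lemma inj_image_subset_eq:
  fixes \<theta> :: "'n::finite \<Rightarrow> 'n"
  assumes "inj \<theta>" "\<theta> ` S \<subseteq> S"
  shows "\<theta> ` S = S"
  using assms by (intro card_subset_eq) (auto simp: card_image inj_on_subset)

text \<open>
  The function \<open>id(j := k)\<close> describes a selection of rows in which row \<open>k\<close> takes the place of row
  \<open>j\<close>. The set \<open>S\<close> is where two permutation terms can be swapped. On it \<open>\<pi>\<close> followed by this
  selection has to agree with a permutation that preserves \<open>S\<close>. The orbit of \<open>k\<close> under \<open>\<pi>\<close> serves if it
  avoids \<open>j\<close>. Otherwise the selection sends the predecessor of \<open>j\<close> back to \<open>k\<close>, and the segment of the
  orbit from \<open>k\<close> up to that predecessor closes into a cycle of \<open>\<theta>\<close>, the composition of \<open>\<pi>\<close> with the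
  transposition of \<open>j\<close> and \<open>k\<close>.
\<close>

lemma exchange_set:
  fixes \<pi> :: "'n::finite \<Rightarrow> 'n"
  assumes \<pi>: "bij \<pi>" and jk: "j \<noteq> k"
  obtains \<theta> S where "bij \<theta>" "\<theta> ` S = S" "k \<in> S" "j \<notin> S"
    "\<And>r. r \<in> S \<Longrightarrow> (id(j := k)) (\<pi> r) = \<theta> r"
    "\<And>r. r \<notin> S \<Longrightarrow> (id(j := k)) (\<pi> r) = (id(j := k)) (Transposition.transpose j k (\<theta> r))"
proof (cases "\<exists>m. (\<pi> ^^ m) k = j")
  case False
  define S where "S = range (\<lambda>n. (\<pi> ^^ n) k)"
  have "\<pi> ` S \<subseteq> S" unfolding S_def by (auto intro: range_eqI[where x = "Suc _"])
  then have S: "\<pi> ` S = S" using \<pi> by (simp add: inj_image_subset_eq bij_is_inj)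
  have k: "k \<in> S" unfolding S_def by (rule range_eqI[of _ _ 0]) simp
  have j: "j \<notin> S" using False unfolding S_def by auto
  show ?thesis
  proof (rule that[OF \<pi> S k j])
    show "(id(j := k)) (\<pi> r) = \<pi> r" if "r \<in> S" for r
      using that S j by auto
    show "(id(j := k)) (\<pi> r) = (id(j := k)) (Transposition.transpose j k (\<pi> r))" if "r \<notin> S" for r
    proof -
      have "\<pi> r \<noteq> k" using that S k \<pi> by (metis bij_is_inj image_iff injD)
      then show ?thesis using jk by (auto simp: Transposition.transpose_def)
    qed
  qed
next
  case True
  define m where "m = (LEAST m. (\<pi> ^^ m) k = j)"
  have m: "(\<pi> ^^ m) k = j" using True unfolding m_def by (rule LeastI_ex)
  have least: "(\<pi> ^^ n) k \<noteq> j" if "n < m" for n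
    using that unfolding m_def by (rule not_less_Least)
  have "m > 0" using m jk by (cases m) auto
  define S where "S = (\<lambda>n. (\<pi> ^^ n) k) ` {..<m}"
  define \<theta> where "\<theta> = Transposition.transpose j k \<circ> \<pi>"
  have \<theta>: "bij \<theta>" unfolding \<theta>_def using \<pi> by (simp add: bij_comp)
  have k: "k \<in> S" unfolding S_def using \<open>m > 0\<close> by (intro image_eqI[of _ _ 0]) auto
  have j: "j \<notin> S" using least unfolding S_def by auto
  \<comment> \<open>Returning to \<open>k\<close> before reaching \<open>j\<close> would give an earlier visit to \<open>j\<close>.\<close>
  have not_k: "\<pi> r \<noteq> k" if "r \<in> S" for r
  proof
    assume eq: "\<pi> r = k"
    from that obtain n where n: "n < m" "r = (\<pi> ^^ n) k" unfolding S_def by auto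
    then have "(\<pi> ^^ (m - Suc n)) k = (\<pi> ^^ (m - Suc n)) ((\<pi> ^^ Suc n) k)" using eq by simp
    also have "\<dots> = (\<pi> ^^ (m - Suc n + Suc n)) k" by (simp only: funpow_add comp_apply)
    also have "\<dots> = j" using m n by simp
    finally show False using least[of "m - Suc n"] n by simp
  qed
  have \<theta>_S: "(\<pi> r = j \<and> \<theta> r = k) \<or> (\<pi> r \<noteq> j \<and> \<theta> r = \<pi> r)" if "r \<in> S" for r
    using not_k[OF that] by (auto simp: \<theta>_def Transposition.transpose_def)
  have "\<theta> ` S \<subseteq> S"
  proof
    fix x assume "x \<in> \<theta> ` S"
    then obtain n where n: "n < m" "x = \<theta> ((\<pi> ^^ n) k)" unfolding S_def by auto
    then have r: "(\<pi> ^^ n) k \<in> S" unfolding S_def by auto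
    show "x \<in> S"
    proof (cases "Suc n = m")
      case True
      then have "\<pi> ((\<pi> ^^ n) k) = j" using m by auto
      then show ?thesis using \<theta>_S[OF r] n k by auto
    next
      case False
      then have "Suc n < m" using n by simp
      then have "(\<pi> ^^ Suc n) k \<in> S" "(\<pi> ^^ Suc n) k \<noteq> j" using least unfolding S_def by blast+
      then show ?thesis using \<theta>_S[OF r] n by auto
    qed
  qed
  then have S: "\<theta> ` S = S" using \<theta> by (simp add: inj_image_subset_eq bij_is_inj)
  show ?thesis
  proof (rule that[OF \<theta> S k j])
    show "(id(j := k)) (\<pi> r) = \<theta> r" if "r \<in> S" for r
      using \<theta>_S[OF that] by auto
    show "(id(j := k)) (\<pi> r) = (id(j := k)) (Transposition.transpose j k (\<theta> r))" if "r \<notin> S" for r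
      by (simp add: \<theta>_def)
  qed
qed

lemma bij_if_invariant:
  fixes \<theta> :: "'n::finite \<Rightarrow> 'n"
  assumes "bij \<theta>" "\<theta> ` S = S"
  shows "bij (\<lambda>r. if r \<in> S then \<theta> r else r)"
proof -
  have "inj (\<lambda>r. if r \<in> S then \<theta> r else r)"
    using assms by (intro injI) (metis bij_is_inj image_eqI injD)
  then show ?thesis by (intro bijI finite_UNIV_inj_surj) auto
qed

text \<open>
  The left-hand side assigns two rows to each column \<open>c = \<sigma> r\<close>: the row selected at \<open>r\<close> by the first
  factor, and the row selected at \<open>\<pi> r\<close> by the second, where \<open>\<pi>\<close> is the composition of \<open>\<sigma>\<close> with the
  inverse of \<open>\<tau>\<close>. For distinct indices the first factor lacks row \<open>k\<close> and the second has it twice. Swapping the two rows in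
  the columns of an exchange set, which contains \<open>k\<close> but not \<open>j\<close>, turns the first assignment into a
  bijection \<open>\<alpha>\<close>, and moves the additional copy of row \<open>i\<close> to the second, where it takes the place of
  row \<open>j\<close>.
\<close>

lemma exchange_terms:
  fixes A :: "('l::comm_ring_1, 'f::linordered_ab_group_add) elt ^ 'n ^ 'n"
  assumes \<sigma>: "\<sigma> permutes UNIV" and \<tau>: "\<tau> permutes UNIV" and jk: "j \<noteq> k"
  obtains \<sigma>' \<tau>' where "\<sigma>' permutes UNIV" "\<tau>' permutes UNIV"
    "(\<Prod>r\<in>UNIV. A $ (id(k := i)) r $ \<sigma> r) * (\<Prod>r\<in>UNIV. A $ (id(j := k)) r $ \<tau> r) =
     (\<Prod>r\<in>UNIV. A $ r $ \<sigma>' r) * (\<Prod>r\<in>UNIV. A $ (id(j := i)) r $ \<tau>' r)"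
proof -
  define \<pi> where "\<pi> = inv \<tau> \<circ> \<sigma>"
  have \<pi>_perm: "\<pi> permutes UNIV"
    unfolding \<pi>_def using \<sigma> \<tau> by (simp add: permutes_compose permutes_inv)
  have \<tau>\<pi>: "\<tau> (\<pi> r) = \<sigma> r" for r
    by (simp add: \<pi>_def permutes_inverses[OF \<tau>])
  obtain \<theta> S where \<theta>: "bij \<theta>" and S: "\<theta> ` S = S" and k: "k \<in> S" and j: "j \<notin> S"
    and on: "\<And>r. r \<in> S \<Longrightarrow> (id(j := k)) (\<pi> r) = \<theta> r"
    and out: "\<And>r. r \<notin> S \<Longrightarrow> (id(j := k)) (\<pi> r) = (id(j := k)) (Transposition.transpose j k (\<theta> r))"
    using exchange_set[OF permutes_bij[OF \<pi>_perm] jk] by metis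
  define \<alpha> where "\<alpha> = (\<lambda>r. if r \<in> S then \<theta> r else r)"
  \<comment> \<open>With the transposition the index selecting row \<open>j\<close> is \<open>k\<close> inside \<open>S\<close>, where row \<open>i\<close> came from,
    and the index mapped by \<open>\<theta>\<close> to \<open>j\<close> outside \<open>S\<close> selects row \<open>k\<close>.\<close>
  define \<beta> where "\<beta> = Transposition.transpose j k \<circ> (\<lambda>r. if r \<in> - S then \<theta> r else r)"
  have "\<theta> ` (- S) = - S" using \<theta> S by (simp add: bij_image_Compl_eq)
  then have "bij (\<lambda>r. if r \<in> - S then \<theta> r else r)"
    using \<theta> by (intro bij_if_invariant)
  then have "bij \<beta>"
    unfolding \<beta>_def by (rule bij_comp) simp
  have "bij \<alpha>"
    unfolding \<alpha>_def using \<theta> S by (rule bij_if_invariant)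
  have \<alpha>: "\<alpha> permutes UNIV" and \<beta>: "\<beta> permutes UNIV"
    using \<open>bij \<alpha>\<close> \<open>bij \<beta>\<close> by (auto intro: bij_imp_permutes)
  have pointwise: "A $ (id(k := i)) r $ \<sigma> r * A $ (id(j := k)) (\<pi> r) $ \<sigma> r =
      A $ \<alpha> r $ \<sigma> r * A $ (id(j := i)) (\<beta> r) $ \<sigma> r" for r
  proof (cases "r \<in> S")
    case True
    then have "(id(j := k)) (\<pi> r) = \<alpha> r" by (simp only: on \<alpha>_def if_True)
    moreover have "(id(j := i)) (\<beta> r) = (id(k := i)) r"
      using True j by (auto simp: \<beta>_def Transposition.transpose_def)
    ultimately show ?thesis by (simp only: mult.commute)
  next
    case False
    have "\<theta> r \<noteq> k" using False S k \<theta> by (metis bij_is_inj image_iff injD)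
    have "(id(j := k)) (\<pi> r) = (id(j := k)) (Transposition.transpose j k (\<theta> r))"
      using False by (rule out)
    also have "\<dots> = (id(j := i)) (\<beta> r)"
      using False \<open>\<theta> r \<noteq> k\<close> jk by (auto simp: \<beta>_def Transposition.transpose_def)
    finally have "(id(j := k)) (\<pi> r) = (id(j := i)) (\<beta> r)" .
    moreover have "(id(k := i)) r = \<alpha> r" using False k by (auto simp: \<alpha>_def)
    ultimately show ?thesis by (simp only:)
  qed
  have "(\<Prod>r\<in>UNIV. A $ (id(k := i)) r $ \<sigma> r) * (\<Prod>r\<in>UNIV. A $ (id(j := k)) r $ \<tau> r) =
      (\<Prod>r\<in>UNIV. A $ (id(k := i)) r $ \<sigma> r) * (\<Prod>r\<in>UNIV. A $ (id(j := k)) (\<pi> r) $ \<sigma> r)"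
    using prod.permute[OF \<pi>_perm, of "\<lambda>r. A $ (id(j := k)) r $ \<tau> r"]
    by (simp only: o_def \<tau>\<pi>)
  also have "\<dots> = (\<Prod>r\<in>UNIV. A $ \<alpha> r $ \<sigma> r) * (\<Prod>r\<in>UNIV. A $ (id(j := i)) (\<beta> r) $ \<sigma> r)"
    by (simp only: pointwise prod.distrib [symmetric])
  also have "(\<Prod>r\<in>UNIV. A $ \<alpha> r $ \<sigma> r) = (\<Prod>r\<in>UNIV. A $ r $ (\<sigma> \<circ> inv \<alpha>) r)"
    using prod.permute[OF \<alpha>, of "\<lambda>r. A $ r $ (\<sigma> \<circ> inv \<alpha>) r"]
    by (simp only: o_def permutes_inverses[OF \<alpha>])
  also have "(\<Prod>r\<in>UNIV. A $ (id(j := i)) (\<beta> r) $ \<sigma> r) =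
      (\<Prod>r\<in>UNIV. A $ (id(j := i)) r $ (\<sigma> \<circ> inv \<beta>) r)"
    using prod.permute[OF \<beta>, of "\<lambda>r. A $ (id(j := i)) r $ (\<sigma> \<circ> inv \<beta>) r"]
    by (simp only: o_def permutes_inverses[OF \<beta>])
  finally show ?thesis
    by (rule that[rotated 2]) (intro permutes_compose permutes_inv \<sigma> \<alpha> \<beta>)+
qed

lemma term_value_le_elt_det:
  fixes A :: "('l::comm_ring_1, 'f::linordered_ab_group_add) elt ^ 'n ^ 'n"
  assumes "\<sigma> permutes UNIV"
  shows "(\<Prod>r\<in>UNIV. A $ r $ \<sigma> r) \<preceq> elt_det A"
proof -
  have "1 * (\<Prod>r\<in>UNIV. A $ r $ \<sigma> r) \<preceq> sign_elt \<sigma> * (\<Prod>r\<in>UNIV. A $ r $ \<sigma> r)"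
    by (intro value_le_mult one_value_le_sign_elt value_le_refl)
  also have "\<dots> \<preceq> elt_det A"
    unfolding elt_det_sign_elt using assms
    by (intro member_value_le_sum) (auto simp: finite_permutations)
  finally show ?thesis by simp
qed

text \<open>
  Signs have value zero, so the exchange of terms bounds every term of the left-hand side by the
  product of a term of each factor on the right.
\<close>

lemma elt_det_exchange:
  fixes A :: "('l::comm_ring_1, 'f::linordered_ab_group_add) elt ^ 'n ^ 'n"
  shows "elt_det (select_rows A (id(k := i))) * elt_det (select_rows A (id(j := k))) \<preceq>
    elt_det A * elt_det (select_rows A (id(j := i)))"
proof (cases "j = k")
  case True
  then have "select_rows A (id(j := k)) = A" by (simp add: select_rows_def vec_eq_iff)
  then show ?thesis using True by (simp add: mult.commute)
next
  case False
  show ?thesis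
    unfolding elt_det_sign_elt[of "select_rows A (id(k := i))"]
      elt_det_sign_elt[of "select_rows A (id(j := k))"] sum_product
  proof (intro value_le_sum)
    fix \<sigma> \<tau> :: "'n \<Rightarrow> 'n"
    assume "\<sigma> \<in> {\<sigma>. \<sigma> permutes UNIV}" "\<tau> \<in> {\<sigma>. \<sigma> permutes UNIV}"
    then obtain \<sigma>' \<tau>' where perm: "\<sigma>' permutes UNIV" "\<tau>' permutes UNIV"
      and eq: "(\<Prod>r\<in>UNIV. A $ (id(k := i)) r $ \<sigma> r) * (\<Prod>r\<in>UNIV. A $ (id(j := k)) r $ \<tau> r) =
        (\<Prod>r\<in>UNIV. A $ r $ \<sigma>' r) * (\<Prod>r\<in>UNIV. A $ (id(j := i)) r $ \<tau>' r)"
      using exchange_terms[OF _ _ False, of \<sigma> \<tau> A i] by blast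
    let ?P = "\<Prod>r\<in>UNIV. select_rows A (id(k := i)) $ r $ \<sigma> r"
    let ?Q = "\<Prod>r\<in>UNIV. select_rows A (id(j := k)) $ r $ \<tau> r"
    have "(sign_elt \<sigma> * ?P) * (sign_elt \<tau> * ?Q) \<preceq> (1 * ?P) * (1 * ?Q)"
      by (intro value_le_mult sign_elt_value_le_one value_le_refl)
    also have "(1 * ?P) * (1 * ?Q) =
        (\<Prod>r\<in>UNIV. A $ r $ \<sigma>' r) * (\<Prod>r\<in>UNIV. select_rows A (id(j := i)) $ r $ \<tau>' r)"
      using eq by (simp only: select_rows_def vec_lambda_beta mult_1)
    finally show "(sign_elt \<sigma> * ?P) * (sign_elt \<tau> * ?Q) \<preceq>
        elt_det A * elt_det (select_rows A (id(j := i)))"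
      by (rule value_le_trans) (intro value_le_mult term_value_le_elt_det perm)
  qed
qed

section \<open>The normalized adjugate is a quasi-inverse\<close>

text \<open>
  A factor \<open>E\<^sub>i\<^sub>k * E\<^sub>k\<^sub>j\<close> with \<open>i \<mapsto> k \<mapsto> j\<close> under \<open>\<sigma>\<close> is bounded by \<open>E\<^sub>i\<^sub>j * E\<^sub>k\<^sub>k\<close>. This takes \<open>k\<close> out
  of its cycle, and induction on the set of moved indices ends at the product of the diagonal.
\<close>

lemma prod_value_le_one_of_transitive:
  fixes E :: "('l::comm_ring_1, 'f::linordered_ab_group_add) elt ^ 'n ^ 'n"
  assumes diag: "\<And>i. E $ i $ i = 1"
    and trans: "\<And>i j k. E $ i $ k * E $ k $ j \<preceq> E $ i $ j"
    and "finite S" "\<sigma> permutes S"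
  shows "(\<Prod>r\<in>UNIV. E $ r $ \<sigma> r) \<preceq> 1"
  using assms(3,4)
proof (induction S arbitrary: \<sigma> rule: finite_induct)
  case empty
  then show ?case by (simp add: diag)
next
  case (insert k S)
  show ?case
  proof (cases "\<sigma> k = k")
    case True
    then have "\<sigma> permutes S" using insert.prems by (auto intro: permutes_superset)
    then show ?thesis by (rule insert.IH)
  next
    case False
    define i where "i = inv \<sigma> k"
    define \<sigma>' where "\<sigma>' = Transposition.transpose k (\<sigma> k) \<circ> \<sigma>"
    have \<sigma>': "\<sigma>' permutes S" unfolding \<sigma>'_def using insert.prems by (rule permutes_insert_lemma)
    have \<sigma>i: "\<sigma> i = k" by (simp add: i_def permutes_inverses[OF insert.prems])
    then have ik: "i \<noteq> k" using False by auto
    have other: "\<sigma>' r = \<sigma> r" if "r \<noteq> i" "r \<noteq> k" for r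
    proof -
      have "\<sigma> r \<noteq> k" "\<sigma> r \<noteq> \<sigma> k"
        using that \<sigma>i permutes_inj[OF insert.prems] by (metis injD)+
      then show ?thesis by (simp add: \<sigma>'_def)
    qed
    have split: "(\<Prod>r\<in>UNIV. E $ r $ \<rho> r) =
        (E $ i $ \<rho> i * E $ k $ \<rho> k) * (\<Prod>r\<in>UNIV - {i, k}. E $ r $ \<rho> r)" for \<rho>
    proof -
      have "(\<Prod>r\<in>UNIV. E $ r $ \<rho> r) = E $ i $ \<rho> i * (\<Prod>r\<in>UNIV - {i}. E $ r $ \<rho> r)"
        by (simp add: prod.remove[of UNIV i])
      also have "(\<Prod>r\<in>UNIV - {i}. E $ r $ \<rho> r) =
          E $ k $ \<rho> k * (\<Prod>r\<in>UNIV - {i} - {k}. E $ r $ \<rho> r)"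
        using ik by (intro prod.remove) auto
      also have "UNIV - {i} - {k} = UNIV - {i, k}" by auto
      finally show ?thesis by (simp add: mult.assoc)
    qed
    have "(\<Prod>r\<in>UNIV. E $ r $ \<sigma> r) =
        (E $ i $ k * E $ k $ \<sigma> k) * (\<Prod>r\<in>UNIV - {i, k}. E $ r $ \<sigma> r)"
      by (simp add: split[of \<sigma>] \<sigma>i)
    also have "\<dots> \<preceq> E $ i $ \<sigma> k * (\<Prod>r\<in>UNIV - {i, k}. E $ r $ \<sigma> r)"
      by (intro value_le_mult trans value_le_refl)
    also have "E $ i $ \<sigma> k * (\<Prod>r\<in>UNIV - {i, k}. E $ r $ \<sigma> r) = (\<Prod>r\<in>UNIV. E $ r $ \<sigma>' r)"
    proof -
      have "\<sigma>' i = \<sigma> k" "\<sigma>' k = k" by (simp_all add: \<sigma>'_def \<sigma>i)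
      moreover have "(\<Prod>r\<in>UNIV - {i, k}. E $ r $ \<sigma>' r) = (\<Prod>r\<in>UNIV - {i, k}. E $ r $ \<sigma> r)"
        by (rule prod.cong) (auto simp: other)
      ultimately show ?thesis by (simp add: split[of \<sigma>'] diag)
    qed
    also have "\<dots> \<preceq> 1" using \<sigma>' by (rule insert.IH)
    finally show ?thesis .
  qed
qed

text \<open>
  Transitivity says that all terms but one in an entry of \<open>E ** E\<close> are absorbed by the remaining
  one, which is the entry of \<open>E\<close>. In the same way it lets the identity permutation absorb the other
  terms of the determinant.
\<close>

lemma quasi_identity_if_transitive:
  fixes E :: "('l::comm_ring_1, 'f::linordered_ab_group_add) elt ^ 'n ^ 'n"
  assumes diag: "\<And>i. E $ i $ i = 1"
    and off: "\<And>i j. i \<noteq> j \<Longrightarrow> layer (E $ i $ j) = 0"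
    and trans: "\<And>i j k. E $ i $ k * E $ k $ j \<preceq> E $ i $ j"
  shows "quasi_identity E"
proof -
  have "(\<Sum>k\<in>UNIV. E $ i $ k * E $ k $ j) = E $ i $ j" for i j
  proof -
    have "(\<Sum>k\<in>UNIV. E $ i $ k * E $ k $ j) = E $ i $ j + (\<Sum>k\<in>UNIV - {j}. E $ i $ k * E $ k $ j)"
      by (simp add: sum.remove[of UNIV j] diag)
    also have "\<dots> = E $ i $ j"
      by (intro layer_zero_absorbed layer_zero_sum value_le_sum trans) (simp add: layer_mult off)
    finally show ?thesis .
  qed
  then have idempotent: "E ** E = E" by (simp add: matrix_matrix_mult_def vec_eq_iff)
  define z where "z = (\<Sum>\<sigma> | \<sigma> permutes (UNIV :: 'n set) \<and> \<sigma> \<noteq> id.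
    sign_elt \<sigma> * (\<Prod>i\<in>UNIV. E $ i $ \<sigma> i))"
  have det: "elt_det E = 1 + z" "layer z = 0"
    using elt_det_unit_diagonal[of E] diag off unfolding z_def by blast+
  have "z \<preceq> 1 * 1"
    unfolding z_def
    by (intro value_le_sum value_le_mult sign_elt_value_le_one prod_value_le_one_of_transitive[of E UNIV])
      (auto simp: diag trans)
  then have "elt_det E = 1" using det by (simp add: layer_zero_absorbed)
  then show ?thesis
    using idempotent diag off by (simp add: quasi_identity_def elt_nonsingular_def one_elt_def)
qed

text \<open>
  Prescribing \<open>\<sigma> i = j\<close> replaces the deletion of a row and a column, so that the index type does not
  change. The sign of \<open>\<sigma>\<close> includes the usual sign of the cofactor.
\<close>

definition cofactor :: "('l::comm_ring_1, 'f::linordered_ab_group_add) elt ^ 'n ^ 'n \<Rightarrow>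
    'n \<Rightarrow> 'n \<Rightarrow> ('l, 'f) elt" where
  "cofactor A i j =
    (\<Sum>\<sigma> | \<sigma> permutes UNIV \<and> \<sigma> i = j. sign_elt \<sigma> * (\<Prod>r\<in>UNIV - {i}. A $ r $ \<sigma> r))"

lemma cofactor_transpose:
  fixes A :: "('l::comm_ring_1, 'f::linordered_ab_group_add) elt ^ 'n ^ 'n"
  shows "cofactor (transpose A) j i = cofactor A i j"
  unfolding cofactor_def
proof (rule sum.reindex_bij_witness[of _ inv inv])
  fix \<sigma> :: "'n \<Rightarrow> 'n" assume "\<sigma> \<in> {\<sigma>. \<sigma> permutes UNIV \<and> \<sigma> j = i}"
  then have \<sigma>: "\<sigma> permutes UNIV" "\<sigma> j = i" by auto
  show "inv (inv \<sigma>) = \<sigma>" using \<sigma> by (simp add: permutes_inv_inv)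
  show "inv \<sigma> \<in> {\<sigma>. \<sigma> permutes UNIV \<and> \<sigma> i = j}"
    using \<sigma> by (auto simp: permutes_inv permutes_inverses)
  have "(\<Prod>r\<in>UNIV - {i}. A $ r $ inv \<sigma> r) = (\<Prod>r\<in>UNIV - {j}. transpose A $ r $ \<sigma> r)"
    using \<sigma> by (intro prod.reindex_bij_witness[of _ \<sigma> "inv \<sigma>"])
      (auto simp: permutes_inverses transpose_def permutes_inv_eq dest: injD[OF permutes_inj])
  then show "sign_elt (inv \<sigma>) * (\<Prod>r\<in>UNIV - {i}. A $ r $ inv \<sigma> r) =
      sign_elt \<sigma> * (\<Prod>r\<in>UNIV - {j}. transpose A $ r $ \<sigma> r)"
    using \<sigma> by (simp add: sign_elt_def sign_inverse permutation_if_permutes_UNIV)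
next
  fix \<sigma> :: "'n \<Rightarrow> 'n" assume "\<sigma> \<in> {\<sigma>. \<sigma> permutes UNIV \<and> \<sigma> i = j}"
  then show "inv (inv \<sigma>) = \<sigma>" "inv \<sigma> \<in> {\<sigma>. \<sigma> permutes UNIV \<and> \<sigma> j = i}"
    by (auto simp: permutes_inv_inv permutes_inv permutes_inverses)
qed

text \<open>
  Laplace expansion along row \<open>j\<close>, after its replacement by row \<open>i\<close>: the cofactors along a row do not
  depend on that row.
\<close>

lemma sum_row_cofactor:
  fixes A :: "('l::comm_ring_1, 'f::linordered_ab_group_add) elt ^ 'n ^ 'n"
  shows "(\<Sum>k\<in>UNIV. A $ i $ k * cofactor A j k) = elt_det (select_rows A (id(j := i)))"
proof -
  have row: "(\<Prod>r\<in>UNIV. select_rows A (id(j := i)) $ r $ \<sigma> r) =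
      A $ i $ \<sigma> j * (\<Prod>r\<in>UNIV - {j}. A $ r $ \<sigma> r)" for \<sigma>
    by (simp add: prod.remove[of UNIV j] select_rows_def)
  have "(\<Sum>k\<in>UNIV. A $ i $ k * cofactor A j k) =
      (\<Sum>k\<in>UNIV. \<Sum>\<sigma> | \<sigma> \<in> {\<sigma>. \<sigma> permutes UNIV} \<and> \<sigma> j = k.
        sign_elt \<sigma> * (A $ i $ \<sigma> j * (\<Prod>r\<in>UNIV - {j}. A $ r $ \<sigma> r)))"
    unfolding cofactor_def sum_distrib_left by (intro sum.cong) (auto simp: ac_simps)
  also have "\<dots> = elt_det (select_rows A (id(j := i)))"
    unfolding elt_det_sign_elt row by (rule sum.group) (auto simp: finite_permutations)
  finally show ?thesis .
qed

definition scaled_adjugate :: "('l, 'f) elt \<Rightarrow>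
    ('l::comm_ring_1, 'f::linordered_ab_group_add) elt ^ 'n ^ 'n \<Rightarrow> ('l, 'f) elt ^ 'n ^ 'n" where
  "scaled_adjugate d A = (\<chi> k j. d * cofactor A j k)"

lemma scaled_adjugate_transpose:
  "transpose (scaled_adjugate d A) = scaled_adjugate d (transpose A)"
  by (simp add: scaled_adjugate_def vec_eq_iff transpose_def cofactor_transpose[unfolded transpose_def])

lemma quasi_identity_mult_scaled_adjugate:
  fixes A :: "('l::comm_ring_1, 'f::linordered_ab_group_add) elt ^ 'n ^ 'n"
  assumes d: "d * elt_det A = 1"
  shows "quasi_identity (A ** scaled_adjugate d A)"
proof -
  define D where "D j i = elt_det (select_rows A (id(j := i)))" for j i
  define E where "E = A ** scaled_adjugate d A"
  have E: "E $ i $ j = d * D j i" for i j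
    by (simp add: E_def D_def matrix_matrix_mult_def scaled_adjugate_def
        sum_row_cofactor [symmetric] sum_distrib_left ac_simps)
  have "quasi_identity E"
  proof (rule quasi_identity_if_transitive)
    show "E $ i $ i = 1" for i
    proof -
      have "select_rows A (id(i := i)) = A" by (simp add: select_rows_def vec_eq_iff)
      then show ?thesis using d by (simp only: E D_def)
    qed
    show "layer (E $ i $ j) = 0" if "i \<noteq> j" for i j
    proof -
      have "\<not> inj (id(j := i))" using that unfolding inj_def by (metis fun_upd_apply id_apply)
      then show ?thesis
        by (simp add: E D_def layer_mult layer_elt_det_select_rows_not_inj)
    qed
    show "E $ i $ k * E $ k $ j \<preceq> E $ i $ j" for i j k
    proof -
      have "E $ i $ k * E $ k $ j = (d * d) * (D k i * D j k)"
        by (simp add: E ac_simps)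
      also have "\<dots> \<preceq> (d * d) * (elt_det A * D j i)"
        unfolding D_def by (intro value_le_mult value_le_refl elt_det_exchange)
      also have "(d * d) * (elt_det A * D j i) = (d * elt_det A) * (d * D j i)"
        by (simp add: ac_simps)
      also have "\<dots> = E $ i $ j" by (simp add: d E)
      finally show ?thesis .
    qed
  qed
  then show ?thesis by (simp add: E_def)
qed

lemma quasi_identity_transpose:
  fixes E :: "('l::comm_ring_1, 'f::linordered_ab_group_add) elt ^ 'n ^ 'n"
  assumes "quasi_identity E"
  shows "quasi_identity (transpose E)"
proof -
  have "transpose E ** transpose E = transpose E"
    using assms by (simp add: quasi_identity_def matrix_transpose_mul [symmetric])
  then show ?thesis
    using assms unfolding quasi_identity_def elt_nonsingular_def elt_det_transpose
    by (auto simp: transpose_def)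
qed

text \<open>
  As the cofactors of the transpose are the transposed cofactors, the product in the other order is
  the transpose of a product of the first kind.
\<close>

lemma quasi_inverse_scaled_adjugate:
  fixes A :: "('l::comm_ring_1, 'f::linordered_ab_group_add) elt ^ 'n ^ 'n"
  assumes d: "d * elt_det A = 1"
  shows "quasi_inverse A (scaled_adjugate d A)"
proof -
  have "quasi_identity (transpose (transpose A ** scaled_adjugate d (transpose A)))"
    using d by (intro quasi_identity_transpose quasi_identity_mult_scaled_adjugate)
      (simp add: elt_det_transpose)
  then have "quasi_identity (scaled_adjugate d A ** A)"
    by (simp add: matrix_transpose_mul scaled_adjugate_transpose [symmetric])
  then show ?thesis
    using quasi_identity_mult_scaled_adjugate[OF d] by (simp add: quasi_inverse_def)
qed

theorem corollary2p28:
  fixes A :: "('l::comm_ring_1, 'f::linordered_ab_group_add) elt ^ 'n ^ 'n"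
  shows "quasi_invertible A \<longleftrightarrow> invertible_in_elt_ring (elt_det A)"
proof
  assume "quasi_invertible A"
  then show "invertible_in_elt_ring (elt_det A)"
    unfolding quasi_invertible_def quasi_inverse_def
    using elt_det_invertible_if_right_quasi_inverse by blast
next
  assume "invertible_in_elt_ring (elt_det A)"
  then obtain d where "d * elt_det A = 1"
    unfolding invertible_in_elt_ring_def by (metis mult.commute)
  then show "quasi_invertible A"
    unfolding quasi_invertible_def using quasi_inverse_scaled_adjugate by blast
qed

end
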